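(* Any PD0L system that is not weakly circular is repetitive. That is, let $G=(\mathcal{A},\varphi,w)$ be a PD0L system; if $G$ is not weakly circular, then $G$ is repetitive.
   Context: Words: $\mathcal{A}$ is a finite alphabet, $\mathcal{A}^*$ is the free monoid of finite words over $\mathcal{A}$ under concatenation, $\varepsilon$ is the empty word, $\mathcal{A}^+=\mathcal{A}^*\setminus\{\varepsilon\}$, and $|u|$ is the length of $u$. A word $u$ is a factor of $x$ if $x=pus$ for some (possibly empty) words $p,s$. $\mathbb{N}$ includes $0$. A D0L system is a triplet $G=(\mathcal{A},\varphi,w)$ where $\varphi$ is an endomorphism of $\mathcal{A}^*$ and $w\in\mathcal{A}^*$ (the axiom). Its language is $L(G)=\{\varphi^n(w): n\in\mathbb{N}\}$, and $S(L(G))$ is the set of all factors of words of $L(G)$. The alphabet is always considered to be minimal, i.e. every letter of $\mathcal{A}$ belongs to $S(L(G))$. $G$ is a PD0L system (propagating D0L system) if $\varphi$ is non-erasing, i.e. $\varphi(a)\neq\varepsilon$ for all $a\in\mathcal{A}$. $G$ is repetitive if for every $k\in\mathbb{N}$ there is a non-empty word $x$ such that $x^k\in S(L(G))$. Interpretations: for a PD0L system $G$, an interpretation of a word $u\in S(L(G))$ is a triplet $(p,v,s)$ with $p,s\in\mathcal{A}^*$ and $v\in\mathcal{A}^+$ such that $\varphi(v)=pus$. Let $u=u_1\cdots u_\ell\in S(L(G))$ and let $(p,v,s)$ and $(p',v',s')$ be two interpretations of $u$, with $v=v_1\cdots v_n$ and $v'=v'_1\cdots v'_m$ (all $u_i,v_i,v'_i$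 being letters). They are synchronized at position $k$ if there exist nonnegative indices $i$ and $j$ (with $i\le n$, $j\le m$) such that $\varphi(v_1\cdots v_i)=p\,u_1\cdots u_k$ and $\varphi(v'_1\cdots v'_j)=p'\,u_1\cdots u_k$. The word $u$ has a synchronizing point at position $k$, where $0\le k\le |u|$, if all its interpretations are pairwise synchronized at position $k$; $u$ has a synchronizing point if it has one at some such position. A PD0L system $G$ is weakly circular if there is a constant $D>0$ such that every word of $S(L(G))$ longer than $2D$ has a synchronizing point.
   Formalization: In an interpretation (p,v,s) the word v is required to lie in S(L(G)), not merely in A^+; with arbitrary v in A^+ the claim fails, e.g. for 0→01, 1→10, c→11, d→00 with axiom cd0. *)

theory Defs
  imports Main "HOL-Library.Sublist"
begin

text \<open>
  Words over the alphabet \<open>A\<close> are the elements of \<^term>\<open>lists A\<close>; the relation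
  \<^const>\<open>sublist\<close> (contiguous) is ``is a factor of''. The endomorphism is a function on
  words that is constrained on \<^term>\<open>lists A\<close> only; that it fixes the empty word follows
  from \<open>\<phi>_append\<close>.
\<close>

locale D0L =
  fixes A :: "'a set"
    and \<phi> :: "'a list \<Rightarrow> 'a list"
    and w :: "'a list"
  assumes finite_alphabet: "finite A"
    and \<phi>_closed: "u \<in> lists A \<Longrightarrow> \<phi> u \<in> lists A"
    and \<phi>_append: "u \<in> lists A \<Longrightarrow> v \<in> lists A \<Longrightarrow> \<phi> (u @ v) = \<phi> u @ \<phi> v"
    and axiom_word: "w \<in> lists A"
    and minimal_alphabet: "a \<in> A \<Longrightarrow> \<exists>n. sublist [a] ((\<phi> ^^ n) w)"
begin

definition L :: "'a list set" where
  "L = {(\<phi> ^^ n) w | n. True}"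

definition S :: "'a list set" where
  "S = {u. \<exists>x\<in>L. sublist u x}"

definition repetitive :: bool where
  "repetitive \<longleftrightarrow> (\<forall>k. \<exists>x. x \<noteq> [] \<and> concat (replicate k x) \<in> S)"

end

locale PD0L = D0L +
  assumes non_erasing: "a \<in> A \<Longrightarrow> \<phi> [a] \<noteq> []"
begin

text \<open>
  An ancestor \<open>v\<close> has to be a factor of the language. Admitting arbitrary nonempty words over
  \<open>A\<close> would give a different notion of weak circularity: for \<open>0 \<mapsto> 01\<close>, \<open>1 \<mapsto> 10\<close>, \<open>c \<mapsto> 11\<close>,
  \<open>d \<mapsto> 00\<close> with axiom \<open>cd0\<close>, every binary word of length at least 2 would have two
  interpretations whose cuts have opposite parity, although the powers occurring in the
  language have bounded exponent.
\<close>

definition is_interpretation :: "'a list \<Rightarrow> 'a list \<times> 'a list \<times> 'a list \<Rightarrow> bool" where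
  "is_interpretation u = (\<lambda>(p, v, s).
     p \<in> lists A \<and> s \<in> lists A \<and> v \<in> S \<and> v \<noteq> [] \<and> \<phi> v = p @ u @ s)"

definition synchronized_at ::
  "'a list \<Rightarrow> nat \<Rightarrow> 'a list \<times> 'a list \<times> 'a list \<Rightarrow> 'a list \<times> 'a list \<times> 'a list \<Rightarrow> bool" where
  "synchronized_at u k = (\<lambda>(p, v, s) (p', v', s').
     \<exists>i j. i \<le> length v \<and> j \<le> length v' \<and>
       \<phi> (take i v) = p @ take k u \<and> \<phi> (take j v') = p' @ take k u)"

definition sync_point_at :: "'a list \<Rightarrow> nat \<Rightarrow> bool" where
  "sync_point_at u k \<longleftrightarrow> k \<le> length u \<and>
     (\<forall>I I'. is_interpretation u I \<longrightarrow> is_interpretation u I' \<longrightarrow> synchronized_at u k I I')"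

definition has_sync_point :: "'a list \<Rightarrow> bool" where
  "has_sync_point u \<longleftrightarrow> (\<exists>k. sync_point_at u k)"

definition weakly_circular :: bool where
  "weakly_circular \<longleftrightarrow>
     (\<exists>D::nat. D > 0 \<and> (\<forall>u\<in>S. length u > 2 * D \<longrightarrow> has_sync_point u))"

end

end

theory Submission imports Defs begin

text \<open>
  The contrapositive is proved: if some exponent \<open>K\<close> does not occur in the language, then any two
  interpretations of a long word of \<open>S\<close> agree, in cuts and in ancestor letters, except near the
  two ends of the word (\<open>power_free_recognizable\<close>). Then a cut that one interpretation has
  well inside the word is a cut of all of them, hence a synchronizing point (\<open>common_cut\<close>).

  The proof is by induction on the number of letters. Say that a morphism \<^emph>\<open>saves a letter\<close> if it
  factors, through nonerasing morphisms, over an alphabet with fewer letters.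

  If \<open>h\<close> does not save a letter, read two interpretations of the same word from left to right.
  At each moment one of them is ahead of the other by a word \<open>r\<close>, the overhang, which is a
  suffix of the image of a letter. The overhang determines the next letter of the one that lags
  behind: two different continuations \<open>a\<close>, \<open>b\<close> would give two essentially different
  coincidences \<open>r h(u) = h(a) h(v)\<close> and \<open>r h(u') = h(b) h(v')\<close>, and by the defect effect each
  coincidence lowers by one the number of words needed to generate \<open>r\<close> and the images of the
  letters; as only \<open>r\<close> was added, \<open>h\<close> would save a letter (\<open>may_follow_unique\<close>). So the
  overhangs evolve deterministically in a finite set. Either the overhang becomes empty after
  boundedly many steps, and from there on both interpretations use the same letters
  (\<open>synchronized_forward\<close>), or it is periodic, and the word contains a high power
  (\<open>indecomposable_recognizable\<close>).

  If \<open>h = k \<circ> g\<close> over a smaller alphabet, then \<open>h' = g \<circ> k\<close> with axiom \<open>g w\<close> is a system on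
  that smaller alphabet, and \<open>k\<close> maps its language into the one of \<open>h\<close>, so it omits the exponent
  \<open>K\<close> too. Recognizability passes from \<open>h'\<close> to \<open>h\<close> when it is used twice, once for the images
  under \<open>g\<close> of the given interpretations and once for the images of their own ancestors
  (\<open>recognizable_swap_factors\<close>).
\<close>

section \<open>Nonerasing morphisms and factorization through smaller alphabets\<close>

abbreviation hom :: "('a \<Rightarrow> 'b list) \<Rightarrow> 'a list \<Rightarrow> 'b list" where
  "hom h \<equiv> \<lambda>xs. concat (map h xs)"

definition nonerasing_on :: "'a set \<Rightarrow> 'b set \<Rightarrow> ('a \<Rightarrow> 'b list) \<Rightarrow> bool" where
  "nonerasing_on A C h \<longleftrightarrow> (\<forall>a\<in>A. h a \<noteq> [] \<and> h a \<in> lists C)"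

definition total_length :: "'a set \<Rightarrow> ('a \<Rightarrow> 'b list) \<Rightarrow> nat" where
  "total_length A h = (\<Sum>a\<in>A. length (h a))"

definition saves_letters :: "nat \<Rightarrow> 'a set \<Rightarrow> 'b set \<Rightarrow> ('a \<Rightarrow> 'b list) \<Rightarrow> bool" where
  "saves_letters n A C h \<longleftrightarrow> (\<exists>B g k. B \<subseteq> A \<and> card B + n \<le> card A \<and>
     nonerasing_on A B g \<and> nonerasing_on B C k \<and> (\<forall>a\<in>A. h a = hom k (g a)))"

lemma hom_cong_on: "xs \<in> lists A \<Longrightarrow> (\<And>a. a \<in> A \<Longrightarrow> h a = h' a) \<Longrightarrow> hom h xs = hom h' xs"
  by (induction xs) auto

lemma hom_factor_on:
  "xs \<in> lists A \<Longrightarrow> (\<And>a. a \<in> A \<Longrightarrow> h a = hom k (g a)) \<Longrightarrow> hom h xs = hom k (hom g xs)"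
  by (induction xs) auto

lemma hom_closed: "nonerasing_on A C h \<Longrightarrow> xs \<in> lists A \<Longrightarrow> hom h xs \<in> lists C"
  by (induction xs) (auto simp: nonerasing_on_def)

lemma length_hom_ge: "nonerasing_on A C h \<Longrightarrow> xs \<in> lists A \<Longrightarrow> length xs \<le> length (hom h xs)"
proof (induction xs)
  case (Cons a xs)
  then have "length (h a) \<ge> 1" by (auto simp: nonerasing_on_def Suc_le_eq)
  with Cons show ?case by auto
qed simp

lemma hom_eq_Nil_iff: "nonerasing_on A C h \<Longrightarrow> xs \<in> lists A \<Longrightarrow> hom h xs = [] \<longleftrightarrow> xs = []"
  using length_hom_ge[of A C h xs] by (cases xs) (auto simp: nonerasing_on_def)

lemma length_image_le: "finite A \<Longrightarrow> a \<in> A \<Longrightarrow> length (h a) \<le> total_length A h"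
  unfolding total_length_def by (rule member_le_sum) auto

lemma length_hom_le:
  "finite A \<Longrightarrow> xs \<in> lists A \<Longrightarrow> length (hom h xs) \<le> length xs * total_length A h"
proof (induction xs)
  case (Cons a xs)
  then show ?case using length_image_le[of A a h] by auto
qed simp

text \<open>
  Savings add up: a factorization of \<open>h\<close> that saves \<open>m\<close> letters, followed by one of its outer
  factor that saves \<open>n\<close>.
\<close>

lemma saves_letters_trans:
  assumes B: "B \<subseteq> A" "card B + m \<le> card A"
    and t: "nonerasing_on A B t" and ht: "\<And>a. a \<in> A \<Longrightarrow> h a = hom h' (t a)"
    and s: "saves_letters n B C h'"
  shows "saves_letters (m + n) A C h"
proof -
  from s obtain B' g k where k: "B' \<subseteq> B" "card B' + n \<le> card B" "nonerasing_on B B' g"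
    "nonerasing_on B' C k" "\<forall>a\<in>B. h' a = hom k (g a)"
    unfolding saves_letters_def by blast
  have "nonerasing_on A B' (\<lambda>a. hom g (t a))"
    unfolding nonerasing_on_def
  proof (intro ballI conjI)
    fix a assume a: "a \<in> A"
    then have ta: "t a \<noteq> []" "t a \<in> lists B" using t by (auto simp: nonerasing_on_def)
    show "hom g (t a) \<noteq> []" using hom_eq_Nil_iff[OF k(3) ta(2)] ta(1) by blast
    show "hom g (t a) \<in> lists B'" using hom_closed[OF k(3) ta(2)] .
  qed
  moreover have "h a = hom k (hom g (t a))" if "a \<in> A" for a
  proof -
    have "t a \<in> lists B" using t that by (auto simp: nonerasing_on_def)
    then have "hom h' (t a) = hom k (hom g (t a))" by (rule hom_factor_on) (use k(5) in auto)
    with ht[OF that] show ?thesis by simp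
  qed
  ultimately show ?thesis unfolding saves_letters_def
    by (intro exI[of _ B'] exI[of _ "\<lambda>a. hom g (t a)"] exI[of _ k]) (use k B in auto)
qed

lemma saves_letters_refl: "nonerasing_on A C h \<Longrightarrow> saves_letters 0 A C h"
  unfolding saves_letters_def
  by (intro exI[of _ A] exI[of _ "\<lambda>a. [a]"] exI[of _ h]) (auto simp: nonerasing_on_def)

section \<open>The defect effect for finite overlaps\<close>

text \<open>
  A finite substitute for an equality \<open>h(p u) = h(q v)\<close> of right-infinite words. The length
  \<open>total_length A h\<close> of the common prefix is what the reductions below can consume: cancelling
  \<open>h p\<close> shortens the common prefix and the total length by the same amount.
\<close>

definition overlap :: "'a set \<Rightarrow> ('a \<Rightarrow> 'b list) \<Rightarrow> 'a \<Rightarrow> 'a \<Rightarrow> bool" where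
  "overlap A h p q \<longleftrightarrow> p \<in> A \<and> q \<in> A \<and> p \<noteq> q \<and> (\<exists>u\<in>lists A. \<exists>v\<in>lists A. \<exists>y.
     total_length A h \<le> length y \<and> prefix y (hom h (p # u)) \<and> prefix y (hom h (q # v)))"

lemma overlapI:
  "p \<in> A \<Longrightarrow> q \<in> A \<Longrightarrow> p \<noteq> q \<Longrightarrow> u \<in> lists A \<Longrightarrow> v \<in> lists A \<Longrightarrow>
   total_length A h \<le> length y \<Longrightarrow> prefix y (hom h (p # u)) \<Longrightarrow> prefix y (hom h (q # v)) \<Longrightarrow>
   overlap A h p q"
  unfolding overlap_def by blast

lemma overlap_sym: "overlap A h p q \<Longrightarrow> overlap A h q p"
  unfolding overlap_def by blast

lemma overlap_comparable:
  assumes "finite A" "overlap A h p q"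
  shows "prefix (h p) (h q) \<or> prefix (h q) (h p)"
proof -
  from assms(2) obtain u v y where y: "p \<in> A" "q \<in> A"
    "total_length A h \<le> length y" "prefix y (h p @ hom h u)" "prefix y (h q @ hom h v)"
    unfolding overlap_def by auto
  have "prefix (h p) y"
    using y length_image_le[OF assms(1) y(1), of h] by (meson le_trans prefix_length_prefix prefixI)
  moreover have "prefix (h q) y"
    using y length_image_le[OF assms(1) y(2), of h] by (meson le_trans prefix_length_prefix prefixI)
  ultimately show ?thesis by (rule prefix_same_cases)
qed

lemma total_length_update:
  assumes "finite A" "p \<in> A" "q \<in> A" "p \<noteq> q" "h q = h p @ g"
  shows "total_length A (h(q := g)) + length (h p) = total_length A h"
proof -
  have "total_length A h = length (h q) + (\<Sum>a\<in>A - {q}. length (h a))"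
    unfolding total_length_def by (rule sum.remove) (use assms in auto)
  moreover have "total_length A (h(q := g)) = length g + (\<Sum>a\<in>A - {q}. length ((h(q := g)) a))"
    unfolding total_length_def by (subst sum.remove[of A q]) (use assms in auto)
  moreover have "(\<Sum>a\<in>A - {q}. length ((h(q := g)) a)) = (\<Sum>a\<in>A - {q}. length (h a))"
    by (rule sum.cong) auto
  ultimately show ?thesis using assms by simp
qed

text \<open>
  If \<open>h q = h p @ g\<close>, then \<open>h\<close> is the composition of \<open>q \<mapsto> p q\<close> with \<open>h(q := g)\<close>, which has
  smaller total length. This is the reduction step of the defect effect.
\<close>

abbreviation prepend_at :: "'a \<Rightarrow> 'a \<Rightarrow> 'a \<Rightarrow> 'a list" where
  "prepend_at p q c \<equiv> (if c = q then [p, q] else [c])"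

lemma prepend_at_closed:
  "p \<in> A \<Longrightarrow> q \<in> A \<Longrightarrow> u \<in> lists A \<Longrightarrow> hom (prepend_at p q) u \<in> lists A"
  by (induction u) auto

lemma hom_prepend_at:
  "p \<noteq> q \<Longrightarrow> h q = h p @ g \<Longrightarrow> hom (h(q := g)) (hom (prepend_at p q) u) = hom h u"
  by (induction u) auto

text \<open>
  The overlap that triggered the reduction survives it. After the common factor \<open>h p\<close> is
  cancelled, one side starts with \<open>q\<close>, while the other is an image under \<open>q \<mapsto> p q\<close>, and such
  an image never starts with \<open>q\<close>.
\<close>

lemma overlap_cancel:
  assumes A: "finite A" and h: "nonerasing_on A C h"
    and o: "overlap A h p q" and g: "h q = h p @ g" "g \<noteq> []"
  shows "\<exists>c. overlap A (h(q := g)) c q"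
proof -
  from o obtain u v y where y: "p \<in> A" "q \<in> A" "p \<noteq> q" "u \<in> lists A" "v \<in> lists A"
    "total_length A h \<le> length y" "prefix y (h p @ hom h u)" "prefix y (h q @ hom h v)"
    unfolding overlap_def by auto
  let ?h = "h(q := g)" and ?t = "hom (prepend_at p q)"
  have tl: "total_length A ?h + length (h p) = total_length A h"
    using total_length_update[OF A y(1-3) g(1)] .
  have "prefix (h p) y" using y length_image_le[OF A y(1), of h]
    by (meson le_trans prefix_length_prefix prefixI)
  then obtain y' where y': "y = h p @ y'" by (auto simp: prefix_def)
  have len: "total_length A ?h \<le> length y'" using tl y(6) y' by simp
  have p1: "prefix y' (hom h u)" and p2: "prefix y' (g @ hom h v)"
    using y(7,8) y' g(1) by auto
  have "length g \<le> total_length A ?h" using length_image_le[OF A y(2), of ?h] by simp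
  \<comment> \<open>the common prefix is still nonempty, so the other side has a first letter\<close>
  then have "y' \<noteq> []" using len g(2) by auto
  with p1 have "u \<noteq> []" by auto
  then obtain d u' where u: "u = d # u'" by (cases u) auto
  define c where "c = (if d = q then p else d)"
  obtain u'' where u'': "?t u = c # u''" using u c_def by (cases "d = q") auto
  have cA: "c # u'' \<in> lists A" using prepend_at_closed[OF y(1,2,4)] u'' by metis
  have "prefix y' (hom ?h (c # u''))"
    using p1 hom_prepend_at[OF y(3) g(1), of u] u'' by metis
  moreover have "prefix y' (hom ?h (q # ?t v))"
    using p2 hom_prepend_at[OF y(3) g(1), of v] by simp
  moreover have "c \<noteq> q" using y(3) c_def by auto
  ultimately have "overlap A ?h c q"
    unfolding overlap_def using len cA prepend_at_closed[OF y(1,2,5)] y(2) by (auto intro!: bexI)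
  then show ?thesis ..
qed

text \<open>
  Any other overlap survives the reduction as well: its first letters change only if one of them
  is \<open>q\<close>, which becomes \<open>p\<close>. They stay different because \<open>{p', q'}\<close> is not \<open>{p, q}\<close>.
\<close>

lemma overlap_prepend:
  assumes A: "finite A" and pq: "p \<in> A" "q \<in> A" "p \<noteq> q" and g: "h q = h p @ g"
    and o: "overlap A h p' q'" and ne: "{p', q'} \<noteq> {p, q}"
  shows "overlap A (h(q := g)) (if p' = q then p else p') (if q' = q then p else q')"
proof -
  from o obtain u v y where y: "p' \<in> A" "q' \<in> A" "p' \<noteq> q'" "u \<in> lists A" "v \<in> lists A"
    "total_length A h \<le> length y" "prefix y (hom h (p' # u))" "prefix y (hom h (q' # v))"
    unfolding overlap_def by auto
  let ?h = "h(q := g)" and ?t = "hom (prepend_at p q)"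
  have tl: "total_length A ?h \<le> length y"
    using total_length_update[OF A pq g] y(6) by simp
  obtain u' where u': "?t (p' # u) = (if p' = q then p else p') # u'"
    by (cases "p' = q") auto
  obtain v' where v': "?t (q' # v) = (if q' = q then p else q') # v'"
    by (cases "q' = q") auto
  have uA: "?t (p' # u) \<in> lists A" "?t (q' # v) \<in> lists A"
    by (rule prepend_at_closed[OF pq(1,2)]; use y in simp)+
  have "prefix y (hom ?h (?t (p' # u)))" "prefix y (hom ?h (?t (q' # v)))"
    using y(7,8) hom_prepend_at[OF pq(3) g] by metis+
  then show ?thesis using uA y(1-3) ne tl pq unfolding u' v' overlap_def
    by (auto intro!: bexI)
qed

lemma saves_letters_prepend:
  assumes "p \<in> A" "q \<in> A" "p \<noteq> q" "h q = h p @ g" "saves_letters n A C (h(q := g))"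
  shows "saves_letters n A C h"
  using saves_letters_trans[of A A 0 "prepend_at p q" h "h(q := g)" n C] assms
  by (auto simp: nonerasing_on_def)

lemma nonerasing_on_update:
  "nonerasing_on A C h \<Longrightarrow> q \<in> A \<Longrightarrow> h q = h p @ g \<Longrightarrow> g \<noteq> [] \<Longrightarrow> nonerasing_on A C (h(q := g))"
  by (auto simp: nonerasing_on_def)

lemma saves_letters_identify:
  assumes "finite A" "p \<in> A" "q \<in> A" "p \<noteq> q" "h q = h p" "saves_letters n (A - {q}) C h"
  shows "saves_letters (Suc n) A C h"
proof -
  have "card (A - {q}) + 1 \<le> card A"
    using card_Suc_Diff1[of A q] assms(1,3) by simp
  then have "saves_letters (1 + n) A C h"
    using saves_letters_trans[of "A - {q}" A 1 "\<lambda>c. if c = q then [p] else [c]" h h n C] assms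
    by (auto simp: nonerasing_on_def)
  then show ?thesis by simp
qed

lemma nonerasing_on_subset: "nonerasing_on A C h \<Longrightarrow> B \<subseteq> A \<Longrightarrow> nonerasing_on B C h"
  by (auto simp: nonerasing_on_def)

text \<open>
  Cancelling shortens the total length, so the reduction must end with two letters that have the
  same image, and these are identified.
\<close>

lemma overlap_saves_one_letter:
  assumes "finite A" "nonerasing_on A C h" "overlap A h p q"
  shows "saves_letters 1 A C h"
  using assms
proof (induction "total_length A h" arbitrary: h p q rule: less_induct)
  case less
  have *: "saves_letters 1 A C h" if o: "overlap A h p q" and pre: "prefix (h p) (h q)" for p q
  proof -
    from o have pq: "p \<in> A" "q \<in> A" "p \<noteq> q" by (auto simp: overlap_def)
    from pre obtain g where g: "h q = h p @ g" by (auto simp: prefix_def)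
    show ?thesis
    proof (cases "g = []")
      case True
      then show ?thesis
        using saves_letters_identify[OF less.prems(1) pq, of h 0 C] g
          saves_letters_refl[OF nonerasing_on_subset[OF less.prems(2)], of "A - {q}"] by auto
    next
      case False
      obtain c where c: "overlap A (h(q := g)) c q"
        using overlap_cancel[OF less.prems(1,2) o g False] by blast
      have "h p \<noteq> []" using less.prems(2) pq by (auto simp: nonerasing_on_def)
      then have "total_length A (h(q := g)) < total_length A h"
        using total_length_update[where h=h, OF less.prems(1) pq g] by (cases "h p") auto
      from less.hyps[OF this less.prems(1) nonerasing_on_update[OF less.prems(2) pq(2) g False] c]
      show ?thesis by (rule saves_letters_prepend[OF pq g])
    qed
  qed
  show ?case
    using overlap_comparable[OF less.prems(1,3)] *[OF less.prems(3)]
      *[OF overlap_sym[OF less.prems(3)]] by blast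
qed

lemma overlap_identify:
  assumes A: "finite A" and pq: "p \<in> A" "q \<in> A" "p \<noteq> q" "h q = h p"
    and o: "overlap A h p' q'" and ne: "{p', q'} \<noteq> {p, q}"
  shows "overlap (A - {q}) h (if p' = q then p else p') (if q' = q then p else q')"
proof -
  let ?f = "\<lambda>c. if c = q then p else c"
  from o obtain u v y where y: "p' \<in> A" "q' \<in> A" "p' \<noteq> q'" "u \<in> lists A" "v \<in> lists A"
    "total_length A h \<le> length y" "prefix y (hom h (p' # u))" "prefix y (hom h (q' # v))"
    unfolding overlap_def by auto
  have hom: "hom h (map ?f z) = hom h z" for z using pq(4) by (induction z) auto
  have cl: "map ?f z \<in> lists (A - {q})" if "z \<in> lists A" for z
    using that pq by (induction z) auto
  have "total_length (A - {q}) h \<le> total_length A h"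
    unfolding total_length_def by (rule sum_mono2) (use A in auto)
  then have "total_length (A - {q}) h \<le> length y" using y(6) by simp
  moreover have "prefix y (hom h (?f p' # map ?f u))" "prefix y (hom h (?f q' # map ?f v))"
    using y(7,8) hom[of "p' # u"] hom[of "q' # v"] by simp_all
  moreover have "?f p' \<noteq> ?f q'" "?f p' \<in> A - {q}" "?f q' \<in> A - {q}" using y pq ne by auto
  ultimately show ?thesis
    unfolding overlap_def using cl[OF y(4)] cl[OF y(5)] by blast
qed

text \<open>
  Regard an overlap as an edge between its two first letters. The reduction keeps two distinct
  edges distinct: the new edge of the first overlap contains \<open>q\<close>, the one of the second overlap
  does not contain \<open>q\<close>. When the first overlap ends in the identification of two letters, the
  second is still an overlap and saves another letter.
\<close>

lemma two_overlaps_save_two_letters: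
  assumes "finite A" "nonerasing_on A C h" "overlap A h p q" "overlap A h p' q'"
    and "{p', q'} \<noteq> {p, q}"
  shows "saves_letters 2 A C h"
  using assms
proof (induction "total_length A h" arbitrary: h p q p' q' rule: less_induct)
  case less
  note A = less.prems(1) and h = less.prems(2) and o' = less.prems(4)
  have *: "saves_letters 2 A C h" if o: "overlap A h p q" and pre: "prefix (h p) (h q)"
    and ne: "{p', q'} \<noteq> {p, q}" for p q
  proof -
    let ?p = "if p' = q then p else p'" and ?q = "if q' = q then p else q'"
    from o have pq: "p \<in> A" "q \<in> A" "p \<noteq> q" by (auto simp: overlap_def)
    from pre obtain g where g: "h q = h p @ g" by (auto simp: prefix_def)
    show ?thesis
    proof (cases "g = []")
      case True
      then have eq: "h q = h p" using g by simp
      have "saves_letters 1 (A - {q}) C h"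
        by (rule overlap_saves_one_letter[OF _ _ overlap_identify[OF A pq eq o' ne]])
           (use A h in \<open>auto intro: nonerasing_on_subset\<close>)
      then show ?thesis
        using saves_letters_identify[OF A pq eq, of 1 C] by (simp add: numeral_2_eq_2)
    next
      case False
      obtain c where c: "overlap A (h(q := g)) c q"
        using overlap_cancel[OF A h o g False] by blast
      have o2: "overlap A (h(q := g)) ?p ?q" by (rule overlap_prepend[OF A pq g o' ne])
      have "{?p, ?q} \<noteq> {c, q}" using pq(3) by (auto simp: doubleton_eq_iff)
      note IH = less.hyps[OF _ A nonerasing_on_update[OF h pq(2) g False] c o2 this]
      have "h p \<noteq> []" using h pq by (auto simp: nonerasing_on_def)
      then have "total_length A (h(q := g)) < total_length A h"
        using total_length_update[where h=h, OF A pq g] by (cases "h p") auto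
      from IH[OF this] show ?thesis by (rule saves_letters_prepend[OF pq g])
    qed
  qed
  have ne': "{p', q'} \<noteq> {q, p}" using less.prems(5) by (simp add: insert_commute)
  show ?case
    using overlap_comparable[OF A less.prems(3)] *[OF less.prems(3) _ less.prems(5)]
      *[OF overlap_sym[OF less.prems(3)] _ ne'] by blast
qed


section \<open>Without a saving, the overhang determines the next letter\<close>

text \<open>
  Adding \<open>r\<close> as one more generator, represented by \<^const>\<open>None\<close>, raises the number of letters by
  one; saving two letters there is saving one letter of \<open>A\<close>. The smaller alphabet is moved back
  into \<open>A\<close>, so that an induction can stay within one type.
\<close>

lemma saves_letters_optionD:
  assumes A: "finite A" and s: "saves_letters 2 (insert None (Some ` A)) C (case_option r h)"
  shows "saves_letters 1 A C h"
proof -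
  let ?S = "insert None (Some ` A)"
  from s obtain B g k where k: "B \<subseteq> ?S" "card B + 2 \<le> card ?S" "nonerasing_on ?S B g"
    "nonerasing_on B C k" "\<forall>a\<in>?S. case_option r h a = hom k (g a)"
    unfolding saves_letters_def by blast
  have "card ?S = Suc (card A)" using A by (simp add: card_image)
  then have cB: "card B + 1 \<le> card A" using k(2) by simp
  have fB: "finite B" using k(1) A finite_subset by blast
  from cB have "card B \<le> card A" by simp
  then obtain f where f: "inj_on f B" "f ` B \<subseteq> A"
    using inj_on_iff_card_le[OF fB A] by blast
  have "nonerasing_on A (f ` B) (\<lambda>a. map f (g (Some a)))"
    using k(3) by (auto simp: nonerasing_on_def in_lists_conv_set)
  moreover have "nonerasing_on (f ` B) C (\<lambda>b. k (inv_into B f b))"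
    using k(4) f by (auto simp: nonerasing_on_def)
  moreover have "h a = hom (\<lambda>b. k (inv_into B f b)) (map f (g (Some a)))" if "a \<in> A" for a
  proof -
    have "g (Some a) \<in> lists B" using k(3) that by (auto simp: nonerasing_on_def)
    then have "hom k (g (Some a)) = hom (\<lambda>b. k (inv_into B f (f b))) (g (Some a))"
      by (rule hom_cong_on) (use f in auto)
    moreover have "h a = hom k (g (Some a))" using k(5) that by force
    ultimately show ?thesis by (simp add: comp_def)
  qed
  moreover have "card (f ` B) + 1 \<le> card A" using cB card_image[OF f(1)] by simp
  ultimately show ?thesis unfolding saves_letters_def
    by (intro exI[of _ "f ` B"] exI[of _ "\<lambda>a. map f (g (Some a))"]
        exI[of _ "\<lambda>b. k (inv_into B f b)"]) (use f(2) in auto)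
qed

text \<open>
  The letter \<open>a\<close> can continue the lagging interpretation when the other one is ahead by \<open>r\<close> and both
  go on for long enough to give an \<^const>\<open>overlap\<close> over the generators of \<open>A\<close> and \<open>r\<close>.
\<close>

definition may_follow :: "'a set \<Rightarrow> ('a \<Rightarrow> 'b list) \<Rightarrow> 'b list \<Rightarrow> 'a \<Rightarrow> bool" where
  "may_follow A h r a \<longleftrightarrow> a \<in> A \<and> (\<exists>u\<in>lists A. \<exists>v\<in>lists A. \<exists>y.
     length r + total_length A h \<le> length y \<and>
     prefix y (hom h (a # u)) \<and> prefix y (r @ hom h v))"

lemma may_follow_unique:
  assumes A: "finite A" and h: "nonerasing_on A C h" and ns: "\<not> saves_letters 1 A C h"
    and r: "r \<noteq> []" "r \<in> lists C" and aa: "may_follow A h r a" "may_follow A h r a'"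
  shows "a = a'"
proof (rule ccontr)
  assume ne: "a \<noteq> a'"
  let ?S = "insert None (Some ` A)" and ?h = "case_option r h"
  have hom: "hom ?h (map Some u) = hom h u" for u by (simp add: comp_def)
  have tl: "total_length ?S ?h = length r + total_length A h"
    unfolding total_length_def using A by (simp add: sum.reindex)
  have ov: "overlap ?S ?h None (Some c)" if mf: "may_follow A h r c" for c
  proof -
    from mf obtain u v y where y: "c \<in> A" "u \<in> lists A" "v \<in> lists A"
      "length r + total_length A h \<le> length y" "prefix y (hom h (c # u))" "prefix y (r @ hom h v)"
      unfolding may_follow_def by blast
    have "prefix y (hom ?h (None # map Some v))" "prefix y (hom ?h (Some c # map Some u))"
      using y(5,6) hom by simp_all
    moreover have "map Some v \<in> lists ?S" "map Some u \<in> lists ?S" using y(2,3) by auto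
    moreover have "total_length ?S ?h \<le> length y" using tl y(4) by simp
    ultimately show ?thesis using y(1)
      by (intro overlapI[where u = "map Some v" and v = "map Some u" and y = y]) simp_all
  qed
  have "nonerasing_on ?S C ?h" using h r by (auto simp: nonerasing_on_def)
  moreover have "{None, Some a'} \<noteq> {None, Some a}" using ne by (auto simp: doubleton_eq_iff)
  ultimately have "saves_letters 2 ?S C ?h"
    using two_overlaps_save_two_letters[OF _ _ ov[OF aa(1)] ov[OF aa(2)]] A by blast
  with saves_letters_optionD[OF A] ns show False by blast
qed

definition next_letter :: "'a set \<Rightarrow> ('a \<Rightarrow> 'b list) \<Rightarrow> 'b list \<Rightarrow> 'a" where
  "next_letter A h r = (SOME a. may_follow A h r a)"

text \<open>
  After the lagging interpretation has placed the image \<open>b\<close> of its next letter, it either still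
  lags, and the overhang is the rest of \<open>r\<close>, or it has overtaken, and the overhang is the rest of
  \<open>b\<close>. The position of the rear cut advances by \<open>segment\<close>, the shorter one of \<open>b\<close> and \<open>r\<close>.
\<close>

definition next_overhang :: "'a set \<Rightarrow> ('a \<Rightarrow> 'b list) \<Rightarrow> 'b list \<Rightarrow> 'b list" where
  "next_overhang A h r = (let b = h (next_letter A h r) in
     if length b \<le> length r then drop (length b) r else drop (length r) b)"

definition segment :: "'a set \<Rightarrow> ('a \<Rightarrow> 'b list) \<Rightarrow> 'b list \<Rightarrow> 'b list" where
  "segment A h r = (let b = h (next_letter A h r) in if length b \<le> length r then b else r)"

definition overhangs :: "'a set \<Rightarrow> ('a \<Rightarrow> 'b list) \<Rightarrow> 'b list set" where
  "overhangs A h = insert [] {r. \<exists>a\<in>A. suffix r (h a)}"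

text \<open>
  In a word that starts with \<open>t\<close>, preceded by \<open>p\<close> in \<open>hom h v\<close> and by \<open>p'\<close> in
  \<open>hom h v'\<close>, the ancestor \<open>v\<close> has a cut at the end of \<open>t\<close> and \<open>v'\<close> has one at the end
  of \<open>t @ r\<close>.
\<close>

definition cuts :: "('a \<Rightarrow> 'b list) \<Rightarrow> 'a list \<Rightarrow> 'b list \<Rightarrow> 'a list \<Rightarrow> 'b list \<Rightarrow> 'b list \<Rightarrow> 'b list \<Rightarrow> bool" where
  "cuts h v p v' p' r t \<longleftrightarrow> (\<exists>v1 v2 v1' v2'. v = v1 @ v2 \<and> v' = v1' @ v2' \<and>
     hom h v1 = p @ t \<and> hom h v1' = p' @ t @ r)"

lemma finite_overhangs: "finite A \<Longrightarrow> finite (overhangs A h)"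
proof -
  assume "finite A"
  moreover have "{r. \<exists>a\<in>A. suffix r (h a)} = (\<Union>a\<in>A. set (suffixes (h a)))" by auto
  ultimately show ?thesis by (simp add: overhangs_def)
qed

lemma overhangs_appendD: "x @ r \<in> overhangs A h \<Longrightarrow> r \<in> overhangs A h"
  by (auto simp: overhangs_def dest: suffix_appendD)

lemma length_overhang_le:
  "finite A \<Longrightarrow> r \<in> overhangs A h \<Longrightarrow> length r \<le> total_length A h"
  unfolding overhangs_def
  by (auto dest!: suffix_length_le intro: order_trans length_image_le)

text \<open>
  The witness is the first cut at or after the end of \<open>p\<close>.
\<close>

lemma first_cut:
  assumes "v \<in> lists A" "prefix p (hom h v)"
  shows "\<exists>v1 v2 c. v = v1 @ v2 \<and> hom h v1 = p @ c \<and> c \<in> overhangs A h"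
  using assms
proof (induction v arbitrary: p rule: list.induct)
  case Nil
  then show ?case by (auto simp: overhangs_def)
next
  case (Cons a v)
  consider "p = []" | c where "p \<noteq> []" "h a = p @ c" | q where "p = h a @ q" "prefix q (hom h v)"
    using Cons.prems(2) by (auto simp: prefix_append prefix_def append_eq_append_conv2)
  then show ?case
  proof cases
    case 1
    then show ?thesis
      by (intro exI[of _ "[]"] exI[of _ "a # v"]) (auto simp: overhangs_def)
  next
    case 2
    then have "c \<in> overhangs A h" using Cons.prems(1) by (auto simp: overhangs_def suffix_def)
    with 2 show ?thesis by (intro exI[of _ "[a]"] exI[of _ v] exI[of _ c]) auto
  next
    case 3
    with Cons.IH[of q] Cons.prems(1) obtain v1 v2 c
      where "v = v1 @ v2" "hom h v1 = q @ c" "c \<in> overhangs A h" by auto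
    with 3 show ?thesis by (intro exI[of _ "a # v1"] exI[of _ v2] exI[of _ c]) auto
  qed
qed

text \<open>
  One step of the reading: the new overhang and the word read are functions of the old overhang
  alone. Which of the two interpretations lags is not determined, hence the disjunction.
\<close>

lemma cuts_step:
  assumes A: "finite A" and h: "nonerasing_on A C h" and ns: "\<not> saves_letters 1 A C h"
    and v: "v \<in> lists A" "v' \<in> lists A"
    and eq: "hom h v = p @ (t @ y) @ s" "hom h v' = p' @ (t @ y) @ s'"
    and c: "cuts h v p v' p' r t"
    and r: "r \<in> overhangs A h" "r \<noteq> []" and len: "2 * total_length A h \<le> length y"
  shows "segment A h r \<noteq> [] \<and> prefix (segment A h r) y \<and> next_overhang A h r \<in> overhangs A h \<and>
    (cuts h v p v' p' (next_overhang A h r) (t @ segment A h r) \<or>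
     cuts h v' p' v p (next_overhang A h r) (t @ segment A h r))"
proof -
  from c obtain v1 v2 v1' v2' where w: "v = v1 @ v2" "v' = v1' @ v2'"
     "hom h v1 = p @ t" "hom h v1' = p' @ t @ r" unfolding cuts_def by blast
  have e: "hom h v2 = y @ s" "r @ hom h v2' = y @ s'" using eq w by auto
  have lr: "length r \<le> total_length A h" using length_overhang_le[OF A r(1)] .
  have "y \<noteq> []" using len lr r(2) by auto
  then obtain a v3 where v2: "v2 = a # v3" using e(1) by (cases v2) auto
  have aA: "a \<in> A" using v w v2 by auto
  have la: "length (h a) \<le> total_length A h" using length_image_le[OF A aA] .
  have "r \<in> lists C" using r h unfolding overhangs_def nonerasing_on_def
    by (auto dest!: set_mono_suffix)
  moreover have mf: "may_follow A h r a"
  proof -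
    have "length r + total_length A h \<le> length y" using lr len by simp
    moreover have "prefix y (hom h (a # v3))" using e(1) v2 by simp
    moreover have "prefix y (r @ hom h v2')" using e(2) by simp
    moreover have "v3 \<in> lists A" "v2' \<in> lists A" using v w v2 by auto
    ultimately show ?thesis unfolding may_follow_def using aA by blast
  qed
  ultimately have na: "next_letter A h r = a"
    unfolding next_letter_def
    using may_follow_unique[OF A h ns r(2)] by (intro some_equality) blast+
  have "h a \<noteq> []" using h aA by (auto simp: nonerasing_on_def)
  then have sne: "segment A h r \<noteq> []" using na r(2) by (auto simp: segment_def Let_def)
  have pa: "prefix (h a) y" using e(1) v2 la len
    by (metis concat.simps(2) le_add1 le_trans list.simps(9) mult_2 prefixI prefix_length_prefix)
  have pr: "prefix r y" using e(2) lr len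
    by (metis le_add1 le_trans mult_2 prefixI prefix_length_prefix)
  show ?thesis
  proof (cases "length (h a) \<le> length r")
    case True
    then have "prefix (h a) r" using pa pr prefix_length_prefix by blast
    then obtain r' where r': "r = h a @ r'" by (auto simp: prefix_def)
    have nx: "next_overhang A h r = r'" "segment A h r = h a"
      using na True r' by (auto simp: next_overhang_def segment_def)
    have "r' \<in> overhangs A h" using r r' overhangs_appendD by blast
    moreover have "cuts h v p v' p' r' (t @ h a)"
      unfolding cuts_def
      by (rule exI[of _ "v1 @ [a]"], rule exI[of _ v3], rule exI[of _ v1'], rule exI[of _ v2'])
         (use w v2 r' in auto)
    ultimately show ?thesis using nx pa sne by simp
  next
    case False
    then have "prefix r (h a)" using pa pr prefix_length_prefix nat_le_linear by blast
    then obtain r' where r': "h a = r @ r'" by (auto simp: prefix_def)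
    have nx: "next_overhang A h r = r'" "segment A h r = r"
      using na False r' by (auto simp: next_overhang_def segment_def)
    have "r' \<in> overhangs A h" using r' aA by (auto simp: overhangs_def suffix_def)
    moreover have "cuts h v' p' v p r' (t @ r)"
      unfolding cuts_def
      by (rule exI[of _ v1'], rule exI[of _ v2'], rule exI[of _ "v1 @ [a]"], rule exI[of _ v3])
         (use w v2 r' in auto)
    ultimately show ?thesis using nx pr sne by simp
  qed
qed


abbreviation cuts_either :: "('a \<Rightarrow> 'b list) \<Rightarrow> 'a list \<Rightarrow> 'b list \<Rightarrow> 'a list \<Rightarrow> 'b list \<Rightarrow> 'b list \<Rightarrow> 'b list \<Rightarrow> bool" where
  "cuts_either h v p v' p' r t \<equiv> cuts h v p v' p' r t \<or> cuts h v' p' v p r t"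

primrec trace :: "'a set \<Rightarrow> ('a \<Rightarrow> 'b list) \<Rightarrow> nat \<Rightarrow> 'b list \<Rightarrow> 'b list" where
  "trace A h 0 r = []"
| "trace A h (Suc n) r = segment A h r @ trace A h n (next_overhang A h r)"

lemma cuts_steps:
  assumes A: "finite A" and h: "nonerasing_on A C h" and ns: "\<not> saves_letters 1 A C h"
    and v: "v \<in> lists A" "v' \<in> lists A"
    and eq: "hom h v = p @ u @ s" "hom h v' = p' @ u @ s'"
  shows "u = t @ y \<Longrightarrow> cuts_either h v p v' p' r t \<Longrightarrow> r \<in> overhangs A h \<Longrightarrow>
    (\<And>m. m < n \<Longrightarrow> (next_overhang A h ^^ m) r \<noteq> []) \<Longrightarrow>
    (n + 2) * total_length A h \<le> length y \<Longrightarrow>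
    \<exists>y'. y = trace A h n r @ y' \<and> length (trace A h n r) \<le> n * total_length A h \<and>
      (0 < n \<longrightarrow> trace A h n r \<noteq> []) \<and> (next_overhang A h ^^ n) r \<in> overhangs A h \<and>
      cuts_either h v p v' p' ((next_overhang A h ^^ n) r) (t @ trace A h n r)"
proof (induction n arbitrary: r t y)
  case 0
  then show ?case by simp
next
  case (Suc n)
  let ?r = "next_overhang A h r" and ?e = "segment A h r"
  have r: "r \<noteq> []" using Suc.prems(4)[of 0] by simp
  have len: "2 * total_length A h \<le> length y"
    using Suc.prems(5) by (simp add: algebra_simps)
  have eq': "hom h v = p @ (t @ y) @ s" "hom h v' = p' @ (t @ y) @ s'"
    using eq Suc.prems(1) by simp_all
  have st: "?e \<noteq> [] \<and> prefix ?e y \<and> ?r \<in> overhangs A h \<and> cuts_either h v p v' p' ?r (t @ ?e)"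
    using Suc.prems(2)
  proof
    assume "cuts h v p v' p' r t"
    from cuts_step[OF A h ns v eq' this Suc.prems(3) r len] show ?thesis by blast
  next
    assume "cuts h v' p' v p r t"
    from cuts_step[OF A h ns v(2,1) eq'(2,1) this Suc.prems(3) r len] show ?thesis by blast
  qed
  then obtain y1 where y1: "y = ?e @ y1" by (auto simp: prefix_def)
  have le: "length ?e \<le> total_length A h"
    using length_overhang_le[OF A Suc.prems(3)] by (auto simp: segment_def Let_def)
  have ne: "(next_overhang A h ^^ m) ?r \<noteq> []" if "m < n" for m
    using Suc.prems(4)[of "Suc m"] that by (simp add: funpow_Suc_right del: funpow.simps)
  have l1: "(n + 2) * total_length A h \<le> length y1" using Suc.prems(5) le y1 by simp
  have u1: "u = (t @ ?e) @ y1" using Suc.prems(1) y1 by simp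
  from st have st1: "?r \<in> overhangs A h" "cuts_either h v p v' p' ?r (t @ ?e)" by blast+
  from Suc.IH[OF u1 st1(2,1) ne l1] obtain y' where y':
    "y1 = trace A h n ?r @ y'" "length (trace A h n ?r) \<le> n * total_length A h"
    "(next_overhang A h ^^ n) ?r \<in> overhangs A h"
    "cuts_either h v p v' p' ((next_overhang A h ^^ n) ?r) ((t @ ?e) @ trace A h n ?r)"
    by blast
  have "y = trace A h (Suc n) r @ y'" using y1 y'(1) by simp
  moreover have "length (trace A h (Suc n) r) \<le> Suc n * total_length A h"
    using le y'(2) by simp
  moreover have "trace A h (Suc n) r \<noteq> []" using st by simp
  ultimately show ?case using y'(3,4)
    by (simp only: funpow_Suc_right o_apply trace.simps append_assoc) blast
qed

text \<open>
  After a common cut the two ancestors have the same letters until the remaining common part is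
  too short to be an overlap, since an overlap of two different letters would save a letter.
\<close>

lemma synchronized_forward:
  assumes A: "finite A" and h: "nonerasing_on A C h" and ns: "\<not> saves_letters 1 A C h"
    and "v \<in> lists A" "v' \<in> lists A" "hom h v = y @ s" "hom h v' = y @ s'"
  shows "\<exists>x z z' y'. v = x @ z \<and> v' = x @ z' \<and> y = hom h x @ y' \<and> length y' \<le> total_length A h"
  using assms(4-)
proof (induction "length y" arbitrary: v v' y rule: less_induct)
  case less
  show ?case
  proof (cases "length y \<le> total_length A h")
    case True
    then show ?thesis by (intro exI[of _ "[]"] exI[of _ v] exI[of _ v'] exI[of _ y]) simp
  next
    case False
    then have "y \<noteq> []" by auto
    with less.prems obtain a w a' w' where w: "v = a # w" "v' = a' # w'"
      by (cases v; cases v') auto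
    have aa: "a \<in> A" "a' \<in> A" "w \<in> lists A" "w' \<in> lists A" using less.prems w by auto
    have "a = a'"
    proof (rule ccontr)
      assume "a \<noteq> a'"
      moreover have "prefix y (hom h (a # w))" "prefix y (hom h (a' # w'))"
        using less.prems w by simp_all
      ultimately have "overlap A h a a'" unfolding overlap_def using False aa
        by (meson nat_le_linear)
      then show False using overlap_saves_one_letter[OF A h] ns by blast
    qed
    have "prefix (h a) (y @ s)" using less.prems(3) w by (metis concat.simps(2) list.simps(9) prefixI)
    moreover have "length (h a) \<le> length y" using length_image_le[OF A aa(1), of h] False by simp
    ultimately obtain y1 where y1: "y = h a @ y1"
      by (metis prefixE prefixI prefix_length_prefix)
    have "h a \<noteq> []" using h aa by (auto simp: nonerasing_on_def)
    then have "length y1 < length y" using y1 by simp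
    moreover have "hom h w = y1 @ s" "hom h w' = y1 @ s'"
      using less.prems w y1 \<open>a = a'\<close> by simp_all
    ultimately obtain x z z' y' where "w = x @ z" "w' = x @ z'" "y1 = hom h x @ y'"
       "length y' \<le> total_length A h"
      using less.hyps[OF _ aa(3,4)] by blast
    then show ?thesis using w y1 \<open>a = a'\<close>
      by (intro exI[of _ "a # x"] exI[of _ z] exI[of _ z'] exI[of _ y']) simp
  qed
qed

section \<open>Recognizability of morphisms that save no letter\<close>

text \<open>
  The ancestors \<open>v\<close> and \<open>v'\<close> of \<open>u\<close> share a block \<open>x\<close> whose image has the same position in \<open>u\<close>
  for both and covers \<open>u\<close> up to at most \<open>D\<close> letters at either end.
\<close>

definition aligned ::
  "('a \<Rightarrow> 'b list) \<Rightarrow> nat \<Rightarrow> 'b list \<Rightarrow> 'a list \<Rightarrow> 'b list \<Rightarrow> 'a list \<Rightarrow> 'b list \<Rightarrow> bool" where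
  "aligned h D u v p v' p' \<longleftrightarrow> (\<exists>u1 u2 x v1 v2 v1' v2'.
     u = u1 @ hom h x @ u2 \<and> length u1 \<le> D \<and> length u2 \<le> D \<and>
     v = v1 @ x @ v2 \<and> v' = v1' @ x @ v2' \<and> hom h v1 = p @ u1 \<and> hom h v1' = p' @ u1)"

definition recognizable :: "('a \<Rightarrow> 'b list) \<Rightarrow> 'a list set \<Rightarrow> nat \<Rightarrow> bool" where
  "recognizable h V D \<longleftrightarrow> (\<forall>u p v s p' v' s'. v \<in> V \<longrightarrow> v' \<in> V \<longrightarrow>
     hom h v = p @ u @ s \<longrightarrow> hom h v' = p' @ u @ s' \<longrightarrow> D \<le> length u \<longrightarrow>
     aligned h D u v p v' p')"

text \<open>
  The reading starts at the earlier one of the first cuts of both interpretations inside \<open>u\<close>.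
\<close>

lemma cuts_start:
  assumes A: "finite A" and v: "v \<in> lists A" "v' \<in> lists A"
    and eq: "hom h v = p @ u @ s" "hom h v' = p' @ u @ s'"
    and len: "total_length A h \<le> length u"
  shows "\<exists>t y r. u = t @ y \<and> length t \<le> total_length A h \<and> r \<in> overhangs A h \<and>
    cuts_either h v p v' p' r t"
proof -
  obtain v1 v2 c where c: "v = v1 @ v2" "hom h v1 = p @ c" "c \<in> overhangs A h"
    using first_cut[OF v(1), of p h] eq(1) by (auto simp: prefix_def)
  obtain v1' v2' c' where c': "v' = v1' @ v2'" "hom h v1' = p' @ c'" "c' \<in> overhangs A h"
    using first_cut[OF v(2), of p' h] eq(2) by (auto simp: prefix_def)
  note lc = length_overhang_le[OF A c(3)] and lc' = length_overhang_le[OF A c'(3)]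
  have "c @ hom h v2 = u @ s" using c(1,2) eq(1) by simp
  then have "prefix c (u @ s)" by (metis prefixI)
  then have pc: "prefix c u" using lc len by (meson le_trans prefix_length_prefix prefixI)
  have "c' @ hom h v2' = u @ s'" using c'(1,2) eq(2) by simp
  then have "prefix c' (u @ s')" by (metis prefixI)
  then have pc': "prefix c' u" using lc' len by (meson le_trans prefix_length_prefix prefixI)
  from pc pc' have "prefix c c' \<or> prefix c' c" by (rule prefix_same_cases)
  then show ?thesis
  proof
    assume "prefix c c'"
    then obtain r where r: "c' = c @ r" by (auto simp: prefix_def)
    have "cuts h v p v' p' r c" unfolding cuts_def using c c' r by blast
    moreover obtain y where "u = c @ y" using pc by (auto simp: prefix_def)
    ultimately show ?thesis using lc overhangs_appendD c'(3) r by blast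
  next
    assume "prefix c' c"
    then obtain r where r: "c = c' @ r" by (auto simp: prefix_def)
    have "cuts h v' p' v p r c'" unfolding cuts_def using c c' r by blast
    moreover obtain y where "u = c' @ y" using pc' by (auto simp: prefix_def)
    ultimately show ?thesis using lc' overhangs_appendD c(3) r by blast
  qed
qed

lemma funpow_repeats:
  assumes "finite R" "\<And>n. n \<le> card R \<Longrightarrow> (f ^^ n) r \<in> R"
  shows "\<exists>i d. 0 < d \<and> i + d \<le> card R \<and> (f ^^ d) ((f ^^ i) r) = (f ^^ i) r"
proof -
  have "\<not> inj_on (\<lambda>n. (f ^^ n) r) {..card R}"
  proof
    assume "inj_on (\<lambda>n. (f ^^ n) r) {..card R}"
    then have "card {..card R} \<le> card R"
      by (rule card_inj_on_le) (use assms in auto)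
    then show False by simp
  qed
  then obtain m n where mn: "m \<le> card R" "n \<le> card R" "m \<noteq> n" "(f ^^ m) r = (f ^^ n) r"
    by (auto simp: inj_on_def)
  have *: ?thesis if "i < j" "j \<le> card R" "(f ^^ i) r = (f ^^ j) r" for i j
  proof -
    have "(f ^^ (j - i)) ((f ^^ i) r) = (f ^^ j) r"
      using funpow_add[of "j - i" i f] that(1) by simp
    then show ?thesis using that by (intro exI[of _ i] exI[of _ "j - i"]) auto
  qed
  show ?thesis
    using mn *[of m n] *[of n m] by (cases "m < n") auto
qed

text \<open>
  Let \<open>Q\<close> be the number of overhangs. If none of the first \<open>Q + 1\<close> overhangs is empty, two of
  them coincide, at distance \<open>d\<close>; reading \<open>d\<close> steps from there yields the same word \<open>x\<close> each time,
  and a word that is long enough contains \<open>x\<close> to the power \<open>K\<close>.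
\<close>

lemma indecomposable_recognizable:
  assumes A: "finite A" and h: "nonerasing_on A C h" and ns: "\<not> saves_letters 1 A C h"
    and V: "V \<subseteq> lists A"
    and np: "\<And>v x. v \<in> V \<Longrightarrow> x \<noteq> [] \<Longrightarrow> \<not> sublist (concat (replicate K x)) (hom h v)"
  shows "\<exists>D. recognizable h V D"
proof -
  let ?M = "total_length A h" and ?R = "overhangs A h" and ?f = "next_overhang A h"
  define Q where "Q = card ?R"
  \<comment> \<open>one \<open>?M\<close> up to the first cut, at most \<open>Q + K * Q\<close> steps of length at most \<open>?M\<close>, and
    \<open>2 * ?M\<close> to the right of them, as \<open>cuts_step\<close> demands\<close>
  define D where "D = (Q * (K + 1) + 3) * ?M"
  have "aligned h D u v p v' p'"
    if v': "v \<in> V" "v' \<in> V" and eq: "hom h v = p @ u @ s" "hom h v' = p' @ u @ s'"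
      and len: "D \<le> length u" for u p v s p' v' s'
  proof -
    have v: "v \<in> lists A" "v' \<in> lists A" using v' V by auto
    note steps = cuts_steps[OF A h ns v eq]
    have "?M \<le> length u" using len by (simp add: D_def algebra_simps)
    from cuts_start[OF A v eq this] obtain t y r where t: "u = t @ y" "length t \<le> ?M"
      "r \<in> ?R" "cuts_either h v p v' p' r t" by blast
    have ly: "(Q * (K + 1) + 2) * ?M \<le> length y" using len t by (simp add: D_def algebra_simps)
    have en: "(n + 2) * ?M \<le> length y" if "n \<le> Q * (K + 1)" for n
      using ly mult_le_mono1[of "n + 2" "Q * (K + 1) + 2" ?M] that by linarith
    show ?thesis
    proof (cases "\<exists>n\<le>Q. (?f ^^ n) r = []")
      case True
      define n where "n = (LEAST n. (?f ^^ n) r = [])"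
      have n: "(?f ^^ n) r = []" "n \<le> Q"
      proof -
        obtain n0 where n0: "n0 \<le> Q" "(?f ^^ n0) r = []" using True by blast
        show "(?f ^^ n) r = []" unfolding n_def using n0(2) by (rule LeastI)
        have "n \<le> n0" unfolding n_def using n0(2) by (rule Least_le)
        then show "n \<le> Q" using n0(1) by simp
      qed
      have before: "(?f ^^ m) r \<noteq> []" if "m < n" for m
        using that not_less_Least unfolding n_def by blast
      have "n \<le> Q * (K + 1)" using n(2) by simp
      from steps[OF t(1,4,3) before en[OF this]] obtain y' where
        y': "y = trace A h n r @ y'" "length (trace A h n r) \<le> n * ?M"
        "cuts_either h v p v' p' [] (t @ trace A h n r)"
        unfolding n(1) by blast
      let ?t = "t @ trace A h n r"
      from y'(3) obtain v1 v2 v1' v2' where w: "v = v1 @ v2" "v' = v1' @ v2'"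
        "hom h v1 = p @ ?t" "hom h v1' = p' @ ?t"
        unfolding cuts_def append_Nil2 by blast
      have "hom h v2 = y' @ s" "hom h v2' = y' @ s'" using eq w t y' by auto
      moreover have "v2 \<in> lists A" "v2' \<in> lists A" using v w by auto
      ultimately obtain x z z' y2 where x: "v2 = x @ z" "v2' = x @ z'" "y' = hom h x @ y2"
        "length y2 \<le> ?M" using synchronized_forward[OF A h ns, of v2 v2' y' s s'] by blast
      have "length ?t \<le> (Q + 1) * ?M"
        using t(2) y'(2) mult_le_mono1[OF n(2), of ?M]
        unfolding length_append add_mult_distrib mult_1 by linarith
      also have "\<dots> \<le> D" unfolding D_def by (rule mult_le_mono1) simp
      finally have "length ?t \<le> D" .
      moreover have "length y2 \<le> D" using x(4) by (simp add: D_def algebra_simps)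
      moreover have "u = ?t @ hom h x @ y2" using t y' x by simp
      ultimately show ?thesis unfolding aligned_def using w x by blast
    next
      case False
      have inR: "(?f ^^ n) r \<in> ?R" if "n \<le> Q" for n
      proof -
        have "(?f ^^ m) r \<noteq> []" if "m < n" for m using False \<open>n \<le> Q\<close> that by simp
        moreover have "n \<le> Q * (K + 1)" using that by simp
        ultimately show ?thesis using steps[OF t(1,4,3) _ en, of n] by auto
      qed
      obtain i d where id: "0 < d" "i + d \<le> Q" "(?f ^^ d) ((?f ^^ i) r) = (?f ^^ i) r"
        using funpow_repeats[OF finite_overhangs[OF A], of h ?f r] inR unfolding Q_def by blast
      let ?r = "(?f ^^ i) r"
      define x where "x = trace A h d ?r"
      have before: "(?f ^^ m) r \<noteq> []" if "m < i + d" for m using False that id by auto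
      have before_d: "(?f ^^ m) ?r \<noteq> []" if "m < d" for m
        using before[of "m + i"] that by (simp add: funpow_add)
      have "i \<le> Q * (K + 1)" using id(2) by simp
      then obtain y1 where y1: "y = trace A h i r @ y1" "length (trace A h i r) \<le> i * ?M"
        "cuts_either h v p v' p' ?r (t @ trace A h i r)"
        using steps[OF t(1,4,3) before en, of i] by auto
      have rR: "?r \<in> ?R" using inR id by simp
      let ?t = "\<lambda>k. (t @ trace A h i r) @ concat (replicate k x)"
      have "\<exists>y'. u = ?t k @ y' \<and> length y1 \<le> length y' + k * (d * ?M) \<and>
          cuts_either h v p v' p' ?r (?t k) \<and> (0 < k \<longrightarrow> x \<noteq> [])" if "k \<le> K" for k
        using that
      proof (induction k)
        case 0
        then show ?case using t y1 by simp
      next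
        case (Suc k)
        then obtain y' where y': "u = ?t k @ y'" "length y1 \<le> length y' + k * (d * ?M)"
          "cuts_either h v p v' p' ?r (?t k)" by auto
        have "i + k * d + (d + 2) \<le> Q * (K + 1) + 2"
        proof -
          have "(k + 1) * d \<le> K * Q" by (rule mult_le_mono) (use Suc.prems id in auto)
          then show ?thesis using id by (simp add: algebra_simps)
        qed
        from mult_le_mono1[OF this, of ?M]
        have "(d + 2) * ?M \<le> length y'" using ly y1(1,2) y'(2) by (simp add: algebra_simps)
        from steps[OF y'(1,3) rR before_d this] id
        obtain y2 where "y' = x @ y2" "length x \<le> d * ?M" "x \<noteq> []"
          "cuts_either h v p v' p' ?r (?t k @ x)" unfolding x_def by auto
        moreover have "concat (replicate (Suc k) x) = concat (replicate k x) @ x"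
          by (simp flip: replicate_append_same)
        ultimately show ?case using y' by (intro exI[of _ y2]) (simp add: algebra_simps)
      qed
      from this[of K] obtain y' where y': "u = ?t K @ y'" "0 < K \<longrightarrow> x \<noteq> []" by blast
      have "sublist (concat (replicate K x)) (hom h v)"
        unfolding eq(1) y'(1) sublist_def by (metis append.assoc)
      \<comment> \<open>for \<open>K = 0\<close> the empty word would be an excluded power\<close>
      moreover have "0 < K" using np[OF v'(1), of "[undefined]"] by (cases K) auto
      ultimately show ?thesis using np[OF v'(1)] y'(2) by blast
    qed
  qed
  then show ?thesis unfolding recognizable_def by blast
qed


section \<open>Recognizability of systems that omit an exponent\<close>

definition language :: "('a \<Rightarrow> 'a list) \<Rightarrow> 'a list \<Rightarrow> 'a list set" where
  "language h w = {u. \<exists>n. sublist u ((hom h ^^ n) w)}"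

lemma funpow_hom_closed:
  "nonerasing_on A A h \<Longrightarrow> w \<in> lists A \<Longrightarrow> (hom h ^^ n) w \<in> lists A"
proof (induction n)
  case (Suc n)
  then show ?case using hom_closed[of A A h "(hom h ^^ n) w"] by simp
qed simp

lemma language_closed: "nonerasing_on A A h \<Longrightarrow> w \<in> lists A \<Longrightarrow> language h w \<subseteq> lists A"
  unfolding language_def by (auto dest!: set_mono_sublist funpow_hom_closed)

lemma language_sublist: "u \<in> language h w \<Longrightarrow> sublist v u \<Longrightarrow> v \<in> language h w"
  unfolding language_def by (auto intro: sublist_order.order.trans)

lemma sublist_hom: "sublist u v \<Longrightarrow> sublist (hom h u) (hom h v)"
  unfolding sublist_def by (metis concat_append map_append)

lemma language_hom: "u \<in> language h w \<Longrightarrow> hom h u \<in> language h w"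
proof -
  assume "u \<in> language h w"
  then obtain n where "sublist u ((hom h ^^ n) w)" by (auto simp: language_def)
  then have "sublist (hom h u) ((hom h ^^ Suc n) w)" using sublist_hom by fastforce
  then show ?thesis unfolding language_def by blast
qed

lemma long_word_has_ancestor:
  assumes "v \<in> language h w" "length w < length v"
  shows "\<exists>p t s. t \<in> language h w \<and> hom h t = p @ v @ s"
proof -
  obtain n where n: "sublist v ((hom h ^^ n) w)" using assms(1) by (auto simp: language_def)
  obtain m where "n = Suc m"
    using n assms(2) sublist_length_le by (cases n) fastforce+
  then have "sublist v (hom h ((hom h ^^ m) w))" using n by simp
  moreover have "(hom h ^^ m) w \<in> language h w" by (auto simp: language_def)
  ultimately show ?thesis unfolding sublist_def by blast
qed

text \<open>
  A nonerasing morphism is strictly increasing on the prefixes of a word, so positions can be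
  compared after applying it.
\<close>

lemma prefix_if_image_shorter:
  assumes g: "nonerasing_on A C g" and W: "W \<in> lists A" "prefix x W" "prefix y W"
    and le: "length (hom g x) \<le> length (hom g y)"
  shows "prefix x y"
proof -
  from W(2,3) have "prefix x y \<or> prefix y x" by (rule prefix_same_cases)
  moreover have "prefix x y" if yx: "prefix y x"
  proof -
    obtain z where z: "x = y @ z" using yx by (auto simp: prefix_def)
    have "z \<in> lists A" using W(1,2) z by (auto simp: prefix_def)
    moreover have "hom g z = []" using le z by simp
    ultimately have "z = []" using hom_eq_Nil_iff[OF g] by blast
    then show ?thesis using z by simp
  qed
  ultimately show ?thesis by blast
qed

text \<open>
  A factor \<open>F\<close> of a word \<open>P U T\<close> whose image lies inside the image of \<open>U\<close>, at the corresponding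
  position, lies inside \<open>U\<close> itself. This undoes the application of \<open>g\<close> in the next proof.
\<close>

lemma lift_factor:
  assumes g: "nonerasing_on A C g" and W: "E @ F @ H = P @ U @ T" "P @ U @ T \<in> lists A"
    and e: "hom g E = hom g P @ c1" "hom g U = c1 @ hom g F @ c2"
  shows "\<exists>U1 U2. U = U1 @ F @ U2 \<and> E = P @ U1 \<and> hom g U1 = c1 \<and> hom g U2 = c2"
proof -
  let ?W = "P @ U @ T"
  have pr: "prefix P ?W" "prefix (P @ U) ?W" by simp_all
  have pr': "prefix E ?W" "prefix (E @ F) ?W"
    by (metis W(1) prefixI, metis W(1) append.assoc prefixI)
  have "prefix P E" by (rule prefix_if_image_shorter[OF g W(2) pr(1) pr'(1)]) (simp add: e)
  then obtain U1 where U1: "E = P @ U1" by (auto simp: prefix_def)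
  have "prefix (E @ F) (P @ U)"
    by (rule prefix_if_image_shorter[OF g W(2) pr'(2) pr(2)]) (simp add: e)
  then obtain U2 where U2: "P @ U = E @ F @ U2" by (auto simp: prefix_def)
  then have "U = U1 @ F @ U2" using U1 by simp
  moreover have "hom g U1 = c1" using e(1) U1 by simp
  ultimately show ?thesis using U1 e(2) by auto
qed

text \<open>
  Let \<open>h = k \<circ> g\<close> and \<open>h' = g \<circ> k\<close>. If \<open>v\<close> is an ancestor of \<open>u\<close> under \<open>h\<close>, then \<open>g v\<close> is an
  ancestor of \<open>g u\<close> under \<open>h'\<close>. So the \<open>g\<close>-images of two ancestors \<open>v\<close>, \<open>v'\<close> share a long
  block \<open>z\<close>, at the same position with respect to \<open>u\<close>. This alone does not align \<open>v\<close> and \<open>v'\<close>,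
  because \<open>g\<close> need not be injective. But long words \<open>v\<close>, \<open>v'\<close> have ancestors \<open>t\<close>, \<open>t'\<close> themselves,
  and \<open>g t\<close>, \<open>g t'\<close> are ancestors of \<open>z\<close> under \<open>h'\<close>. They share a long block \<open>r\<close>, and
  \<open>k r\<close> is a block of both \<open>v\<close> and \<open>v'\<close>.
\<close>

lemma recognizable_swap_factors:
  assumes fin: "finite A" "finite B"
    and g: "nonerasing_on A B g" and k: "nonerasing_on B A k" and hA: "nonerasing_on A A h"
    and h: "\<And>a. a \<in> A \<Longrightarrow> h a = hom k (g a)" and w: "w \<in> lists A"
    and rec: "recognizable (\<lambda>b. hom g (k b)) (language (\<lambda>b. hom g (k b)) (hom g w)) D'"
  shows "\<exists>D. recognizable h (language h w) D"
proof -
  let ?h' = "\<lambda>b. hom g (k b)" and ?V = "language h w"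
  let ?V' = "language ?h' (hom g w)"
  have hom_h: "hom h x = hom k (hom g x)" if "x \<in> lists A" for x
    using that h by (rule hom_factor_on)
  have hom_h': "hom ?h' z = hom g (hom k z)" for z by (induction z) auto
  have V: "?V \<subseteq> lists A" using language_closed[OF hA w] .
  have power: "(hom ?h' ^^ n) (hom g w) = hom g ((hom h ^^ n) w)" for n
  proof (induction n)
    case (Suc n)
    then show ?case
      using hom_h[OF funpow_hom_closed[OF hA w], of n] hom_h' by simp
  qed simp
  have gV: "hom g v \<in> ?V'" if v: "v \<in> ?V" for v
  proof -
    obtain n where "sublist v ((hom h ^^ n) w)" using v by (auto simp: language_def)
    then have "sublist (hom g v) ((hom ?h' ^^ n) (hom g w))"
      unfolding power by (rule sublist_hom)
    then show ?thesis unfolding language_def by blast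
  qed
  \<comment> \<open>the summands make \<open>z\<close> at least \<open>D'\<close> letters long, \<open>v\<close> and \<open>v'\<close> longer than the axiom,
    and bound what the second use removes from \<open>z\<close>, measured by \<open>k\<close>\<close>
  define D where "D = 3 * D' + D' * total_length B ?h' + length w * total_length A h
    + D' * total_length B k + 1"
  have "aligned h D u v p v' p'"
    if v: "v \<in> ?V" "v' \<in> ?V" and eq: "hom h v = p @ u @ s" "hom h v' = p' @ u @ s'"
      and len: "D \<le> length u" for u p v s p' v' s'
  proof -
    have vA: "v \<in> lists A" "v' \<in> lists A" using v V by auto
    have A: "p @ u @ s \<in> lists A" "p' @ u @ s' \<in> lists A"
      using hom_closed[OF hA vA(1)] hom_closed[OF hA vA(2)] eq by simp_all
    have gu: "length u \<le> length (hom g u)" using A length_hom_ge[OF g] by simp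
    \<comment> \<open>first use: \<open>g v\<close> and \<open>g v'\<close> as ancestors of \<open>g u\<close>\<close>
    have "hom ?h' (hom g v) = hom g p @ hom g u @ hom g s"
      "hom ?h' (hom g v') = hom g p' @ hom g u @ hom g s'"
      unfolding hom_h' using eq hom_h[OF vA(1)] hom_h[OF vA(2)] by simp_all
    moreover have "D' \<le> length (hom g u)" using len gu by (simp add: D_def)
    ultimately have "aligned ?h' D' (hom g u) (hom g v) (hom g p) (hom g v') (hom g p')"
      using rec gV[OF v(1)] gV[OF v(2)] unfolding recognizable_def by blast
    then obtain c1 c2 z z1 z2 z1' z2' where z:
      "hom g u = c1 @ hom ?h' z @ c2" "length c1 \<le> D'" "length c2 \<le> D'"
      "hom g v = z1 @ z @ z2" "hom g v' = z1' @ z @ z2'"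
      "hom ?h' z1 = hom g p @ c1" "hom ?h' z1' = hom g p' @ c1"
      unfolding aligned_def by blast
    have gu': "hom g u = c1 @ hom g (hom k z) @ c2" using z(1) unfolding hom_h' .
    have E: "hom k z1 @ hom k z @ hom k z2 = p @ u @ s"
      "hom k z1' @ hom k z @ hom k z2' = p' @ u @ s'"
      using hom_h[OF vA(1)] hom_h[OF vA(2)] eq z(4,5) by simp_all
    obtain U1 U2 where U: "u = U1 @ hom k z @ U2" "hom k z1 = p @ U1" "hom g U1 = c1" "hom g U2 = c2"
      using lift_factor[OF g E(1) A(1) z(6)[unfolded hom_h'] gu'] by blast
    obtain U1' U2' where U': "u = U1' @ hom k z @ U2'" "hom k z1' = p' @ U1'" "hom g U1' = c1"
      using lift_factor[OF g E(2) A(2) z(7)[unfolded hom_h'] gu'] by blast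
    have uA: "u \<in> lists A" using A by simp
    have pu: "prefix U1 u" "prefix U1' u" by (metis U(1) prefixI, metis U'(1) prefixI)
    have "U1' = U1"
      using prefix_if_image_shorter[OF g uA pu] prefix_if_image_shorter[OF g uA pu(2,1)] U(3) U'(3)
      by (simp add: prefix_order.antisym)
    have vB: "hom g v \<in> lists B" "hom g v' \<in> lists B" using hom_closed[OF g] vA by auto
    have zB: "z \<in> lists B" using vB(1) z(4) by simp
    have "length u \<le> 2 * D' + length (hom ?h' z)" using gu z(1-3) by simp
    also have "\<dots> \<le> 2 * D' + length z * total_length B ?h'"
      using length_hom_le[OF fin(2) zB, of ?h'] by simp
    finally have "D' * total_length B ?h' < length z * total_length B ?h'"
      using len unfolding D_def by linarith
    then have lz: "D' \<le> length z" by simp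
    have long: "length w < length x" if "x \<in> lists A" "length u \<le> length (hom h x)" for x
    proof -
      have "length w * total_length A h < length x * total_length A h"
        using that len length_hom_le[OF fin(1) that(1), of h] unfolding D_def by linarith
      then show ?thesis by simp
    qed
    \<comment> \<open>second use: \<open>g t\<close> and \<open>g t'\<close> as ancestors of \<open>z\<close>\<close>
    obtain a t b where t: "t \<in> ?V" "hom h t = a @ v @ b"
      using long_word_has_ancestor[OF v(1) long[OF vA(1)]] eq by auto
    obtain a' t' b' where t': "t' \<in> ?V" "hom h t' = a' @ v' @ b'"
      using long_word_has_ancestor[OF v(2) long[OF vA(2)]] eq by auto
    have tA: "t \<in> lists A" "t' \<in> lists A" using t t' V by auto
    have "hom ?h' (hom g t) = (hom g a @ z1) @ z @ (z2 @ hom g b)"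
      "hom ?h' (hom g t') = (hom g a' @ z1') @ z @ (z2' @ hom g b')"
      unfolding hom_h' using t(2) t'(2) hom_h[OF tA(1)] hom_h[OF tA(2)] z(4,5) by simp_all
    then have "aligned ?h' D' z (hom g t) (hom g a @ z1) (hom g t') (hom g a' @ z1')"
      using rec gV[OF t(1)] gV[OF t'(1)] lz unfolding recognizable_def by blast
    then obtain d1 d2 r r1 r2 r1' r2' where r:
      "z = d1 @ hom ?h' r @ d2" "length d1 \<le> D'" "length d2 \<le> D'"
      "hom g t = r1 @ r @ r2" "hom g t' = r1' @ r @ r2'"
      "hom ?h' r1 = (hom g a @ z1) @ d1" "hom ?h' r1' = (hom g a' @ z1') @ d1"
      unfolding aligned_def by blast
    have E2: "hom k r1 @ hom k r @ hom k r2 = a @ v @ b"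
      "hom k r1' @ hom k r @ hom k r2' = a' @ v' @ b'"
      using hom_h[OF tA(1)] hom_h[OF tA(2)] t(2) t'(2) r(4,5) by simp_all
    have A2: "a @ v @ b \<in> lists A" "a' @ v' @ b' \<in> lists A"
      using hom_closed[OF hA tA(1)] hom_closed[OF hA tA(2)] t(2) t'(2) by simp_all
    have r1: "hom g (hom k r1) = hom g a @ (z1 @ d1)" "hom g (hom k r1') = hom g a' @ (z1' @ d1)"
      using r(6,7) unfolding hom_h' by simp_all
    have gv: "hom g v = (z1 @ d1) @ hom g (hom k r) @ (d2 @ z2)"
      "hom g v' = (z1' @ d1) @ hom g (hom k r) @ (d2 @ z2')"
      using z(4,5) r(1) unfolding hom_h' by simp_all
    obtain V1 V2 where V1: "v = V1 @ hom k r @ V2" "hom g V1 = z1 @ d1"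
      using lift_factor[OF g E2(1) A2(1) r1(1) gv(1)] by blast
    obtain V1' V2' where V1': "v' = V1' @ hom k r @ V2'" "hom g V1' = z1' @ d1"
      using lift_factor[OF g E2(2) A2(2) r1(2) gv(2)] by blast
    have xA: "V1 \<in> lists A" "V1' \<in> lists A" "hom k r \<in> lists A" using vA V1(1) V1'(1) by auto
    have "u = (U1 @ hom k d1) @ hom h (hom k r) @ (hom k d2 @ U2)"
      using U(1) r(1) unfolding hom_h[OF xA(3)] hom_h' by simp
    moreover have "hom h V1 = p @ (U1 @ hom k d1)" "hom h V1' = p' @ (U1 @ hom k d1)"
      unfolding hom_h[OF xA(1)] hom_h[OF xA(2)] V1(2) V1'(2)
      using U(2) U'(2) \<open>U1' = U1\<close> by simp_all
    moreover have "length (U1 @ hom k d1) \<le> D" "length (hom k d2 @ U2) \<le> D"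
    proof -
      have "length U1 \<le> D'" "length U2 \<le> D'"
        using length_hom_ge[OF g, of U1] length_hom_ge[OF g, of U2] uA U z(2,3) by auto
      moreover have dB: "d1 \<in> lists B" "d2 \<in> lists B" using zB r(1) by auto
      have "length (hom k d1) \<le> D' * total_length B k" "length (hom k d2) \<le> D' * total_length B k"
        using length_hom_le[OF fin(2) dB(1), of k] length_hom_le[OF fin(2) dB(2), of k]
          mult_le_mono1[OF r(2), of "total_length B k"] mult_le_mono1[OF r(3), of "total_length B k"]
        by linarith+
      ultimately show "length (U1 @ hom k d1) \<le> D" "length (hom k d2 @ U2) \<le> D"
        unfolding D_def length_append by linarith+
    qed
    ultimately show ?thesis unfolding aligned_def using V1(1) V1'(1) by blast
  qed
  then show ?thesis unfolding recognizable_def by blast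
qed

lemma hom_replicate: "hom k (concat (replicate n x)) = concat (replicate n (hom k x))"
  by (induction n) auto

text \<open>
  Induction on the size of the alphabet; a factorization through a smaller alphabet is exactly
  what fails in \<open>indecomposable_recognizable\<close>. The system over the smaller alphabet omits
  the exponent \<open>K\<close>, since a power of \<open>x\<close> in its language gives the same power of \<open>k x\<close> in
  the language of \<open>h\<close>.
\<close>

lemma power_free_recognizable:
  assumes "finite A" "nonerasing_on A A h" "w \<in> lists A"
    and "\<And>x. x \<noteq> [] \<Longrightarrow> concat (replicate K x) \<notin> language h w"
  shows "\<exists>D. recognizable h (language h w) D"
  using assms
proof (induction "card A" arbitrary: A h w rule: less_induct)
  case less
  note A = less.prems(1) and hA = less.prems(2) and w = less.prems(3) and pf = less.prems(4)
  have K: "0 < K" using pf[of "[undefined]"] by (cases K) (auto simp: language_def)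
  show ?case
  proof (cases "saves_letters 1 A A h")
    case False
    have "\<not> sublist (concat (replicate K x)) (hom h v)" if "v \<in> language h w" "x \<noteq> []" for v x
      using pf[OF that(2)] language_sublist[OF language_hom[OF that(1)]] by blast
    then show ?thesis
      using indecomposable_recognizable[OF A hA False language_closed[OF hA w]] by blast
  next
    case True
    then obtain B g k where B: "B \<subseteq> A" "card B + 1 \<le> card A" and g: "nonerasing_on A B g"
      and k: "nonerasing_on B A k" and h: "\<And>a. a \<in> A \<Longrightarrow> h a = hom k (g a)"
      unfolding saves_letters_def by blast
    let ?h' = "\<lambda>b. hom g (k b)"
    have fB: "finite B" using B(1) A finite_subset by blast
    have hom_h: "hom h x = hom k (hom g x)" if "x \<in> lists A" for x
      using that h by (rule hom_factor_on)
    have hom_h': "hom ?h' z = hom g (hom k z)" for z by (induction z) auto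
    have power: "hom k ((hom ?h' ^^ n) (hom g w)) = (hom h ^^ Suc n) w" for n
    proof (induction n)
      case 0
      then show ?case using hom_h[OF w] by simp
    next
      case (Suc n)
      have "hom k ((hom ?h' ^^ Suc n) (hom g w))
          = hom k (hom g (hom k ((hom ?h' ^^ n) (hom g w))))"
        using hom_h'[of "(hom ?h' ^^ n) (hom g w)"] by simp
      also have "\<dots> = hom h ((hom h ^^ Suc n) w)"
        unfolding Suc.IH by (rule hom_h[OF funpow_hom_closed[OF hA w], symmetric])
      finally show ?case by simp
    qed
    have h'B: "nonerasing_on B B ?h'"
      unfolding nonerasing_on_def
    proof (intro ballI conjI)
      fix b assume "b \<in> B"
      then have kb: "k b \<noteq> []" "k b \<in> lists A" using k by (auto simp: nonerasing_on_def)
      show "hom g (k b) \<noteq> []" using hom_eq_Nil_iff[OF g kb(2)] kb(1) by blast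
      show "hom g (k b) \<in> lists B" using hom_closed[OF g kb(2)] .
    qed
    have gw: "hom g w \<in> lists B" using hom_closed[OF g w] .
    have pf': "concat (replicate K x) \<notin> language ?h' (hom g w)" if x: "x \<noteq> []" for x
    proof
      assume l: "concat (replicate K x) \<in> language ?h' (hom g w)"
      then have "concat (replicate K x) \<in> lists B" using language_closed[OF h'B gw] by blast
      then have xB: "x \<in> lists B" using K by (cases K) auto
      obtain n where "sublist (concat (replicate K x)) ((hom ?h' ^^ n) (hom g w))"
        using l by (auto simp: language_def)
      from sublist_hom[OF this, of k]
      have "sublist (concat (replicate K (hom k x))) ((hom h ^^ Suc n) w)"
        unfolding hom_replicate power .
      then have "concat (replicate K (hom k x)) \<in> language h w" unfolding language_def by blast
      moreover have "hom k x \<noteq> []" using hom_eq_Nil_iff[OF k xB] x by blast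
      ultimately show False using pf by blast
    qed
    have "card B < card A" using B(2) by simp
    from less.hyps[OF this fB h'B gw pf'] obtain D'
      where "recognizable ?h' (language ?h' (hom g w)) D'" by blast
    from recognizable_swap_factors[OF A fB g k hA h w this] show ?thesis .
  qed
qed

section \<open>Synchronizing points\<close>

text \<open>
  A word has a synchronizing point as soon as all its interpretations have a cut at one common
  position. Such a position is provided by any cut of a fixed interpretation at distance at
  least \<open>D\<close> from both ends, because it lies in the block shared with any other interpretation.
\<close>

lemma common_cut:
  assumes A: "finite A" and hA: "nonerasing_on A C h" and V: "V \<subseteq> lists A"
    and rec: "recognizable h V D" and len: "2 * D + total_length A h \<le> length u"
    and v0: "v0 \<in> V" "hom h v0 = p0 @ u @ s0"
  shows "\<exists>k\<le>length u. \<forall>v p s. v \<in> V \<longrightarrow> hom h v = p @ u @ s \<longrightarrow>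
    (\<exists>i\<le>length v. hom h (take i v) = p @ take k u)"
proof -
  have v0A: "v0 \<in> lists A" using v0 V by auto
  have "hom h v0 = (p0 @ take D u) @ drop D u @ s0"
    using v0(2) by (metis append.assoc append_take_drop_id)
  then have "prefix (p0 @ take D u) (hom h v0)" by (metis prefixI)
  from first_cut[OF v0A this] obtain v1 v2 c where v1: "v0 = v1 @ v2"
    "hom h v1 = p0 @ take D u @ c" "c \<in> overhangs A h" by auto
  have lc: "length c \<le> total_length A h" using length_overhang_le[OF A v1(3)] .
  define k where "k = D + length c"
  have k: "D \<le> k" "k + D \<le> length u" using lc len by (auto simp: k_def)
  have "(take D u @ c) @ hom h v2 = u @ s0" using v0(2) v1(1,2) by simp
  then have "take k ((take D u @ c) @ hom h v2) = take k (u @ s0)" by simp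
  then have tk: "take D u @ c = take k u" using k by (simp add: k_def)
  have "\<exists>i\<le>length v. hom h (take i v) = p @ take k u"
    if v: "v \<in> V" "hom h v = p @ u @ s" for v p s
  proof -
    have "aligned h D u v0 p0 v p" using rec v v0 k unfolding recognizable_def by auto
    then obtain u1 u2 x w1 w2 w1' w2' where x: "u = u1 @ hom h x @ u2" "length u1 \<le> D"
      "length u2 \<le> D" "v0 = w1 @ x @ w2" "v = w1' @ x @ w2'" "hom h w1 = p0 @ u1" "hom h w1' = p @ u1"
      unfolding aligned_def by blast
    have lv: "length (hom h v1) = length p0 + k" using v1(2) tk k by simp
    have "prefix v1 v0" using v1(1) by simp
    moreover have "prefix w1 v0" "prefix (w1 @ x) v0" using x(4) by simp_all
    ultimately have pr: "prefix v1 v0" "prefix w1 v0" "prefix (w1 @ x) v0" .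
    have "prefix w1 v1"
      by (rule prefix_if_image_shorter[OF hA v0A pr(2,1)]) (use lv x(2,6) k in simp)
    then obtain x1 where x1: "v1 = w1 @ x1" by (auto simp: prefix_def)
    have "prefix v1 (w1 @ x)"
      by (rule prefix_if_image_shorter[OF hA v0A pr(1,3)]) (use lv x(1,3,6) k in simp)
    then obtain x2 where x2: "x = x1 @ x2" using x1 by (auto simp: prefix_def)
    have "u1 @ hom h x1 = take k u" using x1 v1(2) x(6) tk by simp
    then have "hom h (take (length (w1' @ x1)) v) = p @ take k u"
      using x(5,7) x2 by simp
    moreover have "length (w1' @ x1) \<le> length v" using x(5) x2 by simp
    ultimately show ?thesis by blast
  qed
  then show ?thesis using k(2) by (intro exI[of _ k]) auto
qed

theorem theorem6:
  fixes A :: "'a set" and \<phi> :: "'a list \<Rightarrow> 'a list" and w :: "'a list"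
  assumes "PD0L A \<phi> w"
    and "\<not> PD0L.weakly_circular A \<phi> w"
  shows "D0L.repetitive \<phi> w"
proof (rule ccontr)
  interpret PD0L A \<phi> w by fact
  assume "\<not> repetitive"
  then obtain K where K: "\<And>x. x \<noteq> [] \<Longrightarrow> concat (replicate K x) \<notin> S"
    unfolding repetitive_def by blast
  define h where "h a = \<phi> [a]" for a
  have "\<phi> [] = []" using \<phi>_append[of "[]" "[]"] by simp
  then have phi: "\<phi> u = hom h u" if "u \<in> lists A" for u
    using that
  proof (induction u rule: list.induct)
    case (Cons a u)
    then show ?case using \<phi>_append[of "[a]" u] by (simp add: h_def)
  qed simp
  have hA: "nonerasing_on A A h"
    using non_erasing \<phi>_closed by (auto simp: nonerasing_on_def h_def)
  have "(\<phi> ^^ n) w = (hom h ^^ n) w" for n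
  proof (induction n)
    case (Suc n)
    then show ?case using phi[OF funpow_hom_closed[OF hA axiom_word], of n] by simp
  qed simp
  then have S: "S = language h w" unfolding S_def L_def language_def by auto
  obtain D where D: "recognizable h S D"
    using power_free_recognizable[OF finite_alphabet hA axiom_word, of K] K unfolding S by blast
  have SA: "S \<subseteq> lists A" unfolding S using language_closed[OF hA axiom_word] .
  have "has_sync_point u" if u: "2 * (D + total_length A h + 1) < length u" for u
  proof (cases "\<exists>I. is_interpretation u I")
    case False
    then have "sync_point_at u 0" by (simp add: sync_point_at_def)
    then show ?thesis unfolding has_sync_point_def by blast
  next
    case True
    then obtain p0 v0 s0 where v0: "v0 \<in> S" "\<phi> v0 = p0 @ u @ s0"
      unfolding is_interpretation_def by auto
    have "v0 \<in> lists A" using v0(1) SA by blast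
    then have v0h: "hom h v0 = p0 @ u @ s0" using v0(2) phi by metis
    have "2 * D + total_length A h \<le> length u" using u by simp
    from common_cut[OF finite_alphabet hA SA D this v0(1) v0h] obtain k where k: "k \<le> length u"
      "\<And>v p s. v \<in> S \<Longrightarrow> hom h v = p @ u @ s \<Longrightarrow>
         \<exists>i\<le>length v. hom h (take i v) = p @ take k u" by blast
    have cut: "\<exists>i\<le>length v. \<phi> (take i v) = p @ take k u" if "is_interpretation u (p, v, s)" for p v s
    proof -
      have v: "v \<in> S" "\<phi> v = p @ u @ s" using that by (auto simp: is_interpretation_def)
      then have vA: "v \<in> lists A" using SA by auto
      then have "\<phi> (take i v) = hom h (take i v)" for i
        by (intro phi) (auto dest: in_set_takeD)
      moreover have "hom h v = p @ u @ s" using v(2) phi[OF vA] by metis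
      ultimately show ?thesis using k(2)[OF v(1)] by metis
    qed
    have "synchronized_at u k I I'" if "is_interpretation u I" "is_interpretation u I'" for I I'
      using that cut unfolding synchronized_at_def by (cases I; cases I') blast
    then have "sync_point_at u k" unfolding sync_point_at_def using k(1) by blast
    then show ?thesis unfolding has_sync_point_def by blast
  qed
  then have weakly_circular
    unfolding weakly_circular_def by (intro exI[of _ "D + total_length A h + 1"]) auto
  with assms(2) show False by blast
qed

end
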